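(* Let $G$ be a finitely generated group and let $\mathcal{F}$ be a family of subgroups of $G$. Then $\mathcal{F}\text{-eq-asdim}\, G = 0$ if and only if $\mathcal{F}$ contains a finite-index subgroup of $G$.
   Context: $G$ is equipped with a fixed word-length metric coming from a finite generating set, and is discrete as a topological group; $\overline{B}(g,\alpha)$ denotes the closed ball in $G$. A family of subgroups of $G$ is a set of subgroups closed under conjugation and under taking subgroups. Let $Y$ be a $G$-set. A subset $U\subseteq Y$ is an $\mathcal{F}$-subset if (a) any two elements $gU$, $g'U$ of its orbit are either equal or disjoint, and (b) its stabiliser $G_U=\{g\in G : gU=U\}$ belongs to $\mathcal{F}$. An $\mathcal{F}$-cover of $Y$ is a cover consisting of $\mathcal{F}$-subsets which is $G$-invariant as a family (if $U$ belongs to it, so does $gU$ for all $g\in G$). It is open if its members are open. For a family $\mathcal{U}$ of subsets of a set $Y$, $\dim\mathcal{U}=\sup_{y\in Y}|\{U\in\mathcal{U} : y\in U\}|-1$. For a cover $\mathcal{U}$ of $G\times Y$, a number $\alpha<\infty$ is a $G$-Lebesgue number of $\mathcal{U}$ if for each $(g,y)\in G\times Y$ there is $U\in\mathcal{U}$ with $\overline{B}(g,\alpha)\times\{y\}\subseteq U$. For a compact $G$-space $\overline{X}$ (a topological space with a $G$-action by homeomorphisms), the equivariant asymptotic dimension $\mathcal{F}\text{-eq-asdim}\, G\times\overline{X}$ is the smallest integer $n$ such that for every $\alpha<\infty$ there is an open $\mathcal{F}$-cover $\mathcal{U}$ of $G\times\overline{X}$ (with the diagonal $G$-action $h(g,x)=(hg,hx)$)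 with $\dim\mathcal{U}\le n$ and having $\alpha$ as a $G$-Lebesgue number; it is infinite if no such $n$ exists. The equivariant asymptotic dimension of the group, $\mathcal{F}\text{-eq-asdim}\, G$, is $\mathcal{F}\text{-eq-asdim}\, G\times\beta G$, where $\beta G$ is the Stone–Čech compactification of the discrete space $G$ with the action extending left multiplication; equivalently, it is the minimal value of $\mathcal{F}\text{-eq-asdim}\, G\times\overline{X}$ over nonempty compact Hausdorff $G$-spaces $\overline{X}$. *)

theory Defs
  imports "HOL-Analysis.Analysis" "HOL-Algebra.Generated_Groups" "HOL-Algebra.Group_Action"
begin

section \<open>Word metrics\<close>

definition word_length :: "('a, 'c) monoid_scheme \<Rightarrow> 'a set \<Rightarrow> 'a \<Rightarrow> nat" where
  "word_length G S g =
     (LEAST n. \<exists>w. length w = n \<and> set w \<subseteq> S \<union> m_inv G ` S \<and> foldr (\<otimes>\<^bsub>G\<^esub>) w \<one>\<^bsub>G\<^esub> = g)"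

text \<open>The metric is the left-invariant one, matching the left translation action of \<open>G\<close> on itself.\<close>

definition word_dist :: "('a, 'c) monoid_scheme \<Rightarrow> 'a set \<Rightarrow> 'a \<Rightarrow> 'a \<Rightarrow> nat" where
  "word_dist G S g h = word_length G S (inv\<^bsub>G\<^esub> g \<otimes>\<^bsub>G\<^esub> h)"

definition word_cball :: "('a, 'c) monoid_scheme \<Rightarrow> 'a set \<Rightarrow> 'a \<Rightarrow> real \<Rightarrow> 'a set" where
  "word_cball G S g \<alpha> = {h \<in> carrier G. real (word_dist G S g h) \<le> \<alpha>}"

section \<open>Families of subgroups and equivariant covers\<close>

definition subgroup_family :: "('a, 'c) monoid_scheme \<Rightarrow> 'a set set \<Rightarrow> bool" where
  "subgroup_family G \<F> \<longleftrightarrow>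
     (\<forall>H\<in>\<F>. subgroup H G) \<and>
     (\<forall>H\<in>\<F>. \<forall>g\<in>carrier G. g <#\<^bsub>G\<^esub> H #>\<^bsub>G\<^esub> inv\<^bsub>G\<^esub> g \<in> \<F>) \<and>
     (\<forall>H\<in>\<F>. \<forall>K. subgroup K G \<and> K \<subseteq> H \<longrightarrow> K \<in> \<F>)"

definition F_subset ::
  "('a, 'c) monoid_scheme \<Rightarrow> 'a set set \<Rightarrow> 'y set \<Rightarrow> ('a \<Rightarrow> 'y \<Rightarrow> 'y) \<Rightarrow> 'y set \<Rightarrow> bool" where
  "F_subset G \<F> Y \<phi> U \<longleftrightarrow>
     U \<subseteq> Y \<and>
     (\<forall>g\<in>carrier G. \<forall>g'\<in>carrier G. \<phi> g ` U = \<phi> g' ` U \<or> \<phi> g ` U \<inter> \<phi> g' ` U = {}) \<and>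
     stabilizer G (\<lambda>g. (`) (\<phi> g)) U \<in> \<F>"

definition F_cover ::
  "('a, 'c) monoid_scheme \<Rightarrow> 'a set set \<Rightarrow> 'y set \<Rightarrow> ('a \<Rightarrow> 'y \<Rightarrow> 'y) \<Rightarrow> 'y set set \<Rightarrow> bool" where
  "F_cover G \<F> Y \<phi> \<U> \<longleftrightarrow>
     \<Union>\<U> = Y \<and> (\<forall>U\<in>\<U>. F_subset G \<F> Y \<phi> U) \<and> (\<forall>U\<in>\<U>. \<forall>g\<in>carrier G. \<phi> g ` U \<in> \<U>)"

text \<open>The supremum is taken in \<open>enat\<close>, so a point lying in infinitely many members gives \<open>\<infinity>\<close>,
  and the dimension is \<open>-1\<close> when \<open>Y\<close> is empty.\<close>

definition cover_dim :: "'y set \<Rightarrow> 'y set set \<Rightarrow> ereal" where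
  "cover_dim Y \<U> =
     ereal_of_enat (SUP y\<in>Y. let \<V> = {U \<in> \<U>. y \<in> U} in if finite \<V> then enat (card \<V>) else \<infinity>) - 1"

definition G_Lebesgue_number ::
  "('a, 'c) monoid_scheme \<Rightarrow> 'a set \<Rightarrow> 'x set \<Rightarrow> ('a \<times> 'x) set set \<Rightarrow> real \<Rightarrow> bool" where
  "G_Lebesgue_number G S Y \<U> \<alpha> \<longleftrightarrow>
     (\<forall>g\<in>carrier G. \<forall>y\<in>Y. \<exists>U\<in>\<U>. word_cball G S g \<alpha> \<times> {y} \<subseteq> U)"

section \<open>Equivariant asymptotic dimension of a compact \<open>G\<close>-space\<close>

text \<open>Maps into \<open>BijGroup E\<close> are extensional, whence the restrictions in the actions below.\<close>

definition compact_G_space ::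
  "('a, 'c) monoid_scheme \<Rightarrow> 'x topology \<Rightarrow> ('a \<Rightarrow> 'x \<Rightarrow> 'x) \<Rightarrow> bool" where
  "compact_G_space G X \<phi> \<longleftrightarrow>
     compact_space X \<and> group_action G (topspace X) \<phi> \<and>
     (\<forall>g\<in>carrier G. homeomorphic_map X X (\<phi> g))"

definition diagonal_action ::
  "('a, 'c) monoid_scheme \<Rightarrow> 'x set \<Rightarrow> ('a \<Rightarrow> 'x \<Rightarrow> 'x) \<Rightarrow> 'a \<Rightarrow> 'a \<times> 'x \<Rightarrow> 'a \<times> 'x" where
  "diagonal_action G E \<phi> h = (\<lambda>(g, x)\<in>carrier G \<times> E. (h \<otimes>\<^bsub>G\<^esub> g, \<phi> h x))"

text \<open>Only used when \<open>compact_G_space G X \<phi>\<close> holds and \<open>S\<close> is a finite generating set of \<open>G\<close>.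
  Every \<open>cover_dim\<close> is at least \<open>-1\<close>, so the infimum is over integers bounded below:
  it is attained, or it is \<open>\<infinity>\<close> because there is no such integer.\<close>

definition eq_asdim ::
  "('a, 'c) monoid_scheme \<Rightarrow> 'a set \<Rightarrow> 'a set set \<Rightarrow> 'x topology \<Rightarrow> ('a \<Rightarrow> 'x \<Rightarrow> 'x) \<Rightarrow> ereal" where
  "eq_asdim G S \<F> X \<phi> =
     Inf {ereal (of_int n) | n :: int. \<forall>\<alpha>::real. \<exists>\<U>.
        F_cover G \<F> (carrier G \<times> topspace X) (diagonal_action G (topspace X) \<phi>) \<U> \<and>
        (\<forall>U\<in>\<U>. openin (prod_topology (discrete_topology (carrier G)) X) U) \<and>
        cover_dim (carrier G \<times> topspace X) \<U> \<le> ereal (of_int n) \<and>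
        G_Lebesgue_number G S (topspace X) \<U> \<alpha>}"

section \<open>The Stone-Cech compactification of a discrete space\<close>

definition ultrafilter_on :: "'a set \<Rightarrow> 'a set set \<Rightarrow> bool" where
  "ultrafilter_on A p \<longleftrightarrow>
     p \<subseteq> Pow A \<and> A \<in> p \<and> {} \<notin> p \<and>
     (\<forall>B\<in>p. \<forall>C\<in>p. B \<inter> C \<in> p) \<and>
     (\<forall>B\<in>p. \<forall>C. B \<subseteq> C \<and> C \<subseteq> A \<longrightarrow> C \<in> p) \<and>
     (\<forall>B. B \<subseteq> A \<longrightarrow> B \<in> p \<or> A - B \<in> p)"

definition ultra_basic :: "'a set \<Rightarrow> 'a set \<Rightarrow> 'a set set set" where
  "ultra_basic A B = {p. ultrafilter_on A p \<and> B \<in> p}"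

definition stone_cech :: "'a set \<Rightarrow> 'a set set topology" where
  "stone_cech A = topology_generated_by (ultra_basic A ` Pow A)"

definition principal_ultrafilter :: "'a set \<Rightarrow> 'a \<Rightarrow> 'a set set" where
  "principal_ultrafilter A a = {B. B \<subseteq> A \<and> a \<in> B}"

text \<open>The lemmas below show that \<open>stone_cech A\<close>, with the embedding \<open>principal_ultrafilter A\<close>, is the
  Stone-Cech compactification of the discrete space \<open>A\<close>.\<close>

lemma ultrafilter_onD:
  assumes "ultrafilter_on A p"
  shows "\<And>B. B \<in> p \<Longrightarrow> B \<subseteq> A" "A \<in> p" "{} \<notin> p"
    "\<And>B C. B \<in> p \<Longrightarrow> C \<in> p \<Longrightarrow> B \<inter> C \<in> p"
    "\<And>B C. B \<in> p \<Longrightarrow> B \<subseteq> C \<Longrightarrow> C \<subseteq> A \<Longrightarrow> C \<in> p"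
    "\<And>B. B \<subseteq> A \<Longrightarrow> B \<in> p \<or> A - B \<in> p"
proof -
  have *: "p \<subseteq> Pow A" "A \<in> p" "{} \<notin> p" "\<forall>B\<in>p. \<forall>C\<in>p. B \<inter> C \<in> p"
    "\<forall>B\<in>p. \<forall>C. B \<subseteq> C \<and> C \<subseteq> A \<longrightarrow> C \<in> p"
    "\<forall>B. B \<subseteq> A \<longrightarrow> B \<in> p \<or> A - B \<in> p"
    using assms unfolding ultrafilter_on_def by - (elim conjE, assumption)+
  show "\<And>B. B \<in> p \<Longrightarrow> B \<subseteq> A" using *(1) by blast
  show "A \<in> p" "{} \<notin> p" by (rule *)+
  show "\<And>B C. B \<in> p \<Longrightarrow> C \<in> p \<Longrightarrow> B \<inter> C \<in> p" using *(4) by simp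
  show "\<And>B C. B \<in> p \<Longrightarrow> B \<subseteq> C \<Longrightarrow> C \<subseteq> A \<Longrightarrow> C \<in> p" using *(5) by simp
  show "\<And>B. B \<subseteq> A \<Longrightarrow> B \<in> p \<or> A - B \<in> p" using *(6) by simp
qed

lemma topspace_stone_cech: "topspace (stone_cech A) = Collect (ultrafilter_on A)"
  by (auto simp: stone_cech_def ultra_basic_def dest: ultrafilter_onD(2))

lemma openin_ultra_basic: "B \<subseteq> A \<Longrightarrow> openin (stone_cech A) (ultra_basic A B)"
  unfolding stone_cech_def by (intro topology_generated_by_Basis) auto

lemma openin_stone_cechD:
  assumes "openin (stone_cech A) W" "p \<in> W"
  shows "\<exists>B\<in>p. ultra_basic A B \<subseteq> W"
proof -
  have "generate_topology_on (ultra_basic A ` Pow A) W"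
    using assms(1) unfolding stone_cech_def by (rule openin_topology_generated_by)
  then show ?thesis using assms(2)
  proof (induction arbitrary: p)
    case (Int U V)
    then have p: "ultrafilter_on A p"
      by (metis IntD1 Int.hyps(1) mem_Collect_eq openin_subset openin_topology_generated_by_iff
          stone_cech_def subsetD topspace_stone_cech)
    obtain B C where BC: "B \<in> p" "C \<in> p" "ultra_basic A B \<subseteq> U" "ultra_basic A C \<subseteq> V"
      using Int by blast
    have "ultra_basic A (B \<inter> C) \<subseteq> ultra_basic A B \<inter> ultra_basic A C"
      using ultrafilter_onD(1)[OF p BC(1)] ultrafilter_onD(1)[OF p BC(2)]
      unfolding ultra_basic_def by (blast intro: ultrafilter_onD(5))
    with BC ultrafilter_onD(4)[OF p] show ?case by blast
  next
    case (UN K)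
    then obtain k B where "k \<in> K" "B \<in> p" "ultra_basic A B \<subseteq> k" by blast
    then show ?case by blast
  qed (auto simp: ultra_basic_def)
qed

lemma ultrafilter_on_principal: "a \<in> A \<Longrightarrow> ultrafilter_on A (principal_ultrafilter A a)"
  by (auto simp: ultrafilter_on_def principal_ultrafilter_def)

lemma ultrafilter_extends:
  assumes sub: "\<B> \<subseteq> Pow A"
    and fip: "\<And>\<C>. finite \<C> \<Longrightarrow> \<C> \<subseteq> \<B> \<Longrightarrow> A \<inter> \<Inter>\<C> \<noteq> {}"
  shows "\<exists>p. ultrafilter_on A p \<and> \<B> \<subseteq> p"
proof -
  define P where "P = {\<D>. \<B> \<subseteq> \<D> \<and> \<D> \<subseteq> Pow A \<and> (\<forall>\<C>. finite \<C> \<longrightarrow> \<C> \<subseteq> \<D> \<longrightarrow> A \<inter> \<Inter>\<C> \<noteq> {})}"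
  have "\<exists>M\<in>P. \<forall>X\<in>P. M \<subseteq> X \<longrightarrow> X = M"
  proof (rule subset_Zorn_nonempty)
    have "\<B> \<in> P" unfolding P_def using sub fip by simp
    then show "P \<noteq> {}" by blast
    fix Ch assume Ch: "Ch \<noteq> {}" "subset.chain P Ch"
    then have ChP: "Ch \<subseteq> P" by (simp add: subset.chain_def)
    have "A \<inter> \<Inter>\<C> \<noteq> {}" if C: "finite \<C>" "\<C> \<subseteq> \<Union>Ch" for \<C>
    proof -
      obtain \<D> where "\<D> \<in> Ch" "\<C> \<subseteq> \<D>"
        using finite_subset_Union_chain[OF C Ch] by blast
      moreover from \<open>\<D> \<in> Ch\<close> have "\<D> \<in> P" using ChP by (rule subsetD[rotated])
      ultimately show ?thesis using C(1) by (simp add: P_def)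
    qed
    moreover have "\<B> \<subseteq> \<D> \<and> \<D> \<subseteq> Pow A" if "\<D> \<in> Ch" for \<D>
      using subsetD[OF ChP that] by (simp add: P_def)
    then have "\<B> \<subseteq> \<Union>Ch" "\<Union>Ch \<subseteq> Pow A" using Ch(1) by blast+
    ultimately show "\<Union>Ch \<in> P" unfolding P_def by simp
  qed
  then obtain M where M: "M \<in> P" and max: "\<And>X. X \<in> P \<Longrightarrow> M \<subseteq> X \<Longrightarrow> X = M" by blast
  have MA: "M \<subseteq> Pow A" and BM: "\<B> \<subseteq> M"
    and Mfip: "\<And>\<C>. finite \<C> \<Longrightarrow> \<C> \<subseteq> M \<Longrightarrow> A \<inter> \<Inter>\<C> \<noteq> {}"
    using M by (auto simp: P_def)
  have crit: "B \<in> M" if B: "B \<subseteq> A" and meet: "\<And>\<C>. finite \<C> \<Longrightarrow> \<C> \<subseteq> M \<Longrightarrow> B \<inter> (A \<inter> \<Inter>\<C>) \<noteq> {}" for B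
  proof -
    have "A \<inter> \<Inter>\<C> \<noteq> {}" if C: "finite \<C>" "\<C> \<subseteq> insert B M" for \<C>
    proof -
      have "B \<inter> (A \<inter> \<Inter>(\<C> - {B})) \<noteq> {}" using C by (intro meet) auto
      then obtain x where x: "x \<in> A" "x \<in> B" "x \<in> \<Inter>(\<C> - {B})" by auto
      then have "x \<in> \<Inter>\<C>" by (metis DiffI InterE InterI singletonD)
      with x(1) show ?thesis by blast
    qed
    then have "insert B M \<in> P" using MA BM B by (simp add: P_def subset_insertI2)
    then show ?thesis using max by blast
  qed
  have "ultrafilter_on A M"
    unfolding ultrafilter_on_def
  proof (intro conjI ballI allI impI)
    show "M \<subseteq> Pow A" by (rule MA)
    show "A \<in> M" using Mfip by (intro crit) auto
    show "{} \<notin> M"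
    proof
      assume "{} \<in> M"
      then show False using Mfip[of "{{}}"] by auto
    qed
    show "B \<inter> C \<in> M" if "B \<in> M" "C \<in> M" for B C
    proof (rule crit)
      show "B \<inter> C \<subseteq> A" using that MA by auto
      fix \<C> assume "finite \<C>" "\<C> \<subseteq> M"
      then have "A \<inter> \<Inter>(insert B (insert C \<C>)) \<noteq> {}" using that by (intro Mfip) auto
      then show "(B \<inter> C) \<inter> (A \<inter> \<Inter>\<C>) \<noteq> {}" by (simp add: Int_left_commute Int_assoc)
    qed
    show "C \<in> M" if "B \<in> M" "B \<subseteq> C \<and> C \<subseteq> A" for B C
    proof (rule crit)
      show "C \<subseteq> A" using that by auto
      fix \<C> assume "finite \<C>" "\<C> \<subseteq> M"
      then have "A \<inter> \<Inter>(insert B \<C>) \<noteq> {}" using that by (intro Mfip) auto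
      then have "A \<inter> (B \<inter> \<Inter>\<C>) \<noteq> {}" by simp
      moreover have "A \<inter> (B \<inter> \<Inter>\<C>) \<subseteq> C \<inter> (A \<inter> \<Inter>\<C>)"
        using that(2) by (intro Int_greatest) (simp_all add: le_infI1 le_infI2)
      ultimately show "C \<inter> (A \<inter> \<Inter>\<C>) \<noteq> {}" by (metis subset_empty)
    qed
    show "B \<in> M \<or> A - B \<in> M" if B: "B \<subseteq> A" for B
    proof (rule ccontr)
      assume neg: "\<not> (B \<in> M \<or> A - B \<in> M)"
      obtain \<C>1 where 1: "finite \<C>1" "\<C>1 \<subseteq> M" "B \<inter> (A \<inter> \<Inter>\<C>1) = {}"
        using crit[OF B] neg by blast
      obtain \<C>2 where 2: "finite \<C>2" "\<C>2 \<subseteq> M" "(A - B) \<inter> (A \<inter> \<Inter>\<C>2) = {}"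
        using crit[of "A - B"] neg by blast
      have "A \<inter> \<Inter>(\<C>1 \<union> \<C>2) \<noteq> {}" using 1 2 by (intro Mfip) auto
      then obtain x where x: "x \<in> A" "x \<in> \<Inter>\<C>1" "x \<in> \<Inter>\<C>2" by (auto simp: Inter_Un_distrib)
      then have "x \<notin> B" using 1(3) by (metis IntI empty_iff)
      then show False using x 2(3) by (metis DiffI IntI empty_iff)
    qed
  qed
  with BM show ?thesis by blast
qed

lemma ultrafilter_on_finite_Union:
  assumes p: "ultrafilter_on A p" and "finite \<C>" "\<C> \<subseteq> Pow A" "\<Union>\<C> \<in> p"
  shows "\<exists>B\<in>\<C>. B \<in> p"
  using assms(2-)
proof (induction rule: finite_induct)
  case empty
  then show ?case using ultrafilter_onD(3)[OF p] by simp
next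
  case (insert B \<C>)
  show ?case
  proof (cases "B \<in> p")
    case False
    then have "A - B \<in> p" using ultrafilter_onD(6)[OF p, of B] insert.prems by auto
    then have "(A - B) \<inter> \<Union>(insert B \<C>) \<in> p" by (rule ultrafilter_onD(4)[OF p]) (rule insert.prems)
    then have "\<Union>\<C> \<in> p"
      by (rule ultrafilter_onD(5)[OF p]) (use insert.prems in auto)
    then show ?thesis using insert by auto
  qed auto
qed

lemma compact_space_stone_cech: "compact_space (stone_cech A)"
  unfolding compact_space_alt
proof (intro allI impI)
  fix \<W> assume W: "(\<forall>W\<in>\<W>. openin (stone_cech A) W) \<and> topspace (stone_cech A) \<subseteq> \<Union>\<W>"
  define \<B> where "\<B> = {B. B \<subseteq> A \<and> (\<exists>W\<in>\<W>. ultra_basic A (A - B) \<subseteq> W)}"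
  have "\<not> (\<exists>p. ultrafilter_on A p \<and> \<B> \<subseteq> p)"
  proof clarify
    fix p assume p: "ultrafilter_on A p" "\<B> \<subseteq> p"
    then obtain W where "W \<in> \<W>" "p \<in> W" using W by (auto simp: topspace_stone_cech)
    then have "openin (stone_cech A) W" using W by simp
    then obtain B where B: "B \<in> p" "ultra_basic A B \<subseteq> W"
      using openin_stone_cechD[OF _ \<open>p \<in> W\<close>] by auto
    have "B \<subseteq> A" using ultrafilter_onD(1)[OF p(1) B(1)] .
    then have "A - (A - B) = B" by blast
    then have "A - B \<in> \<B>" using B(2) \<open>W \<in> \<W>\<close> by (auto simp: \<B>_def)
    then have "A - B \<in> p" using p(2) by (rule subsetD[rotated])
    then have "B \<inter> (A - B) \<in> p" by (rule ultrafilter_onD(4)[OF p(1) B(1)])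
    then show False using ultrafilter_onD(3)[OF p(1)] by (simp add: Diff_disjoint)
  qed
  moreover have "\<B> \<subseteq> Pow A" by (auto simp: \<B>_def)
  ultimately obtain \<C> where C: "finite \<C>" "\<C> \<subseteq> \<B>" "A \<inter> \<Inter>\<C> = {}"
    using ultrafilter_extends[of \<B> A] by blast
  have "\<forall>B\<in>\<C>. \<exists>W. W \<in> \<W> \<and> ultra_basic A (A - B) \<subseteq> W"
    using C(2) unfolding \<B>_def by blast
  then obtain w where w: "\<And>B. B \<in> \<C> \<Longrightarrow> w B \<in> \<W> \<and> ultra_basic A (A - B) \<subseteq> w B"
    by metis
  have "p \<in> \<Union>(w ` \<C>)" if p: "ultrafilter_on A p" for p
  proof -
    have "\<Union>((\<lambda>B. A - B) ` \<C>) = A" using C(3) by blast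
    then have "\<exists>D\<in>(\<lambda>B. A - B) ` \<C>. D \<in> p"
      using C(1) ultrafilter_onD(2)[OF p] by (intro ultrafilter_on_finite_Union[OF p]) auto
    then obtain B where B: "B \<in> \<C>" "A - B \<in> p" by blast
    then have "p \<in> ultra_basic A (A - B)" using p by (simp add: ultra_basic_def)
    then show ?thesis using w[OF B(1)] B(1) by blast
  qed
  then have "topspace (stone_cech A) \<subseteq> \<Union>(w ` \<C>)" unfolding topspace_stone_cech by blast
  moreover have "finite (w ` \<C>)" "w ` \<C> \<subseteq> \<W>" using C(1) w by blast+
  ultimately show "\<exists>\<V>. finite \<V> \<and> \<V> \<subseteq> \<W> \<and> topspace (stone_cech A) \<subseteq> \<Union>\<V>" by blast
qed

lemma Hausdorff_space_stone_cech: "Hausdorff_space (stone_cech A)"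
  unfolding Hausdorff_space_def
proof clarify
  fix p q assume "p \<in> topspace (stone_cech A)" "q \<in> topspace (stone_cech A)" and "p \<noteq> q"
  then have pq: "ultrafilter_on A p" "ultrafilter_on A q" by (auto simp: topspace_stone_cech)
  have sub: "p = q" if "q \<subseteq> p"
  proof
    show "p \<subseteq> q"
    proof
      fix B assume B: "B \<in> p"
      have "A - B \<notin> p"
        using ultrafilter_onD(4)[OF pq(1) B] ultrafilter_onD(3)[OF pq(1)]
        by (metis Diff_disjoint)
      then show "B \<in> q"
        using that ultrafilter_onD(6)[OF pq(2)] ultrafilter_onD(1)[OF pq(1) B] by blast
    qed
  qed (rule that)
  then obtain B where B: "B \<in> q" "B \<notin> p" using \<open>p \<noteq> q\<close> by blast
  have BA: "B \<subseteq> A" using ultrafilter_onD(1)[OF pq(2) B(1)] .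
  then have "A - B \<in> p" using ultrafilter_onD(6)[OF pq(1)] B(2) by blast
  moreover have "disjnt (ultra_basic A (A - B)) (ultra_basic A B)"
    unfolding disjnt_iff ultra_basic_def
    by (metis (no_types, lifting) Diff_disjoint Int_commute mem_Collect_eq ultrafilter_onD(3,4))
  ultimately show "\<exists>U V. openin (stone_cech A) U \<and> openin (stone_cech A) V \<and> p \<in> U \<and> q \<in> V \<and> disjnt U V"
    using pq B(1) openin_ultra_basic[OF BA] openin_ultra_basic[of "A - B" A]
    by (intro exI[of _ "ultra_basic A (A - B)"] exI[of _ "ultra_basic A B"])
       (auto simp: ultra_basic_def)
qed

lemma embedding_map_principal_ultrafilter:
  "embedding_map (discrete_topology A) (stone_cech A) (principal_ultrafilter A)"
proof -
  have inj: "inj_on (principal_ultrafilter A) A"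
  proof
    fix a b assume ab: "a \<in> A" "b \<in> A" and eq: "principal_ultrafilter A a = principal_ultrafilter A b"
    have "{a} \<in> principal_ultrafilter A a" using ab by (simp add: principal_ultrafilter_def)
    then have "{a} \<in> principal_ultrafilter A b" using eq by simp
    then show "a = b" by (simp add: principal_ultrafilter_def)
  qed
  have top: "principal_ultrafilter A ` A \<subseteq> topspace (stone_cech A)"
    by (auto simp: topspace_stone_cech ultrafilter_on_principal)
  have sing: "openin (subtopology (stone_cech A) (principal_ultrafilter A ` A)) {principal_ultrafilter A a}"
    if a: "a \<in> A" for a
  proof -
    have "ultra_basic A {a} \<inter> principal_ultrafilter A ` A = {principal_ultrafilter A a}"
      using a ultrafilter_on_principal[OF a] by (auto simp: ultra_basic_def principal_ultrafilter_def)
    then show ?thesis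
      using openin_ultra_basic[of "{a}" A] a by (metis empty_subsetI insert_subset openin_subtopology)
  qed
  have "subtopology (stone_cech A) (principal_ultrafilter A ` A) = discrete_topology (principal_ultrafilter A ` A)"
    using sing top by (subst eq_commute, subst discrete_topology_unique) (auto simp: topspace_subtopology)
  then show ?thesis
    unfolding embedding_map_def using inj
    by (simp add: homeomorphic_map_def quotient_map_def inj_on_def subset_image_iff)
qed

lemma dense_principal_ultrafilter:
  "stone_cech A closure_of (principal_ultrafilter A ` A) = topspace (stone_cech A)"
proof (rule antisym[OF closure_of_subset_topspace], rule subsetI)
  fix p assume p: "p \<in> topspace (stone_cech A)"
  then have up: "ultrafilter_on A p" by (simp add: topspace_stone_cech)
  have "\<exists>y\<in>principal_ultrafilter A ` A. y \<in> W" if W: "openin (stone_cech A) W" "p \<in> W" for W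
  proof -
    obtain B where B: "B \<in> p" "ultra_basic A B \<subseteq> W" using openin_stone_cechD[OF W] by blast
    then obtain a where "a \<in> B" using ultrafilter_onD(3)[OF up] by (cases "B = {}") auto
    moreover have "B \<subseteq> A" using ultrafilter_onD(1)[OF up B(1)] .
    ultimately have "a \<in> A" "principal_ultrafilter A a \<in> ultra_basic A B"
      using ultrafilter_on_principal[of a A] by (auto simp: ultra_basic_def principal_ultrafilter_def)
    then show ?thesis using B(2) by blast
  qed
  with p show "p \<in> stone_cech A closure_of (principal_ultrafilter A ` A)"
    by (auto simp: in_closure_of)
qed

text \<open>Uniqueness of the extension follows from density and the Hausdorff property.\<close>

lemma stone_cech_extension:
  assumes K: "compact_space K" "Hausdorff_space K" and f: "f \<in> A \<rightarrow> topspace K"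
  shows "\<exists>F. continuous_map (stone_cech A) K F \<and> (\<forall>a\<in>A. F (principal_ultrafilter A a) = f a)"
proof -
  define pre where "pre U = {a \<in> A. f a \<in> U}" for U
  define L where "L p x \<longleftrightarrow> x \<in> topspace K \<and> (\<forall>U. openin K U \<longrightarrow> x \<in> U \<longrightarrow> pre U \<in> p)" for p x
  have ex: "\<exists>x. L p x" if p: "ultrafilter_on A p" for p
  proof (rule ccontr)
    assume "\<nexists>x. L p x"
    then have nL: "\<And>x. x \<in> topspace K \<Longrightarrow> \<exists>U. openin K U \<and> x \<in> U \<and> pre U \<notin> p"
      by (auto simp: L_def)
    define \<W> where "\<W> = {U. openin K U \<and> pre U \<notin> p}"
    have "topspace K \<subseteq> \<Union>\<W>" using nL by (auto simp: \<W>_def)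
    then obtain \<V> where V: "finite \<V>" "\<V> \<subseteq> \<W>" "topspace K \<subseteq> \<Union>\<V>"
      using K(1) unfolding compact_space_alt \<W>_def by (metis (no_types, lifting) mem_Collect_eq)
    have "\<Union>(pre ` \<V>) = A" using V(3) f by (auto simp: pre_def Pi_iff)
    then have "\<exists>B\<in>pre ` \<V>. B \<in> p"
      using ultrafilter_onD(2)[OF p] V(1)
      by (intro ultrafilter_on_finite_Union[OF p]) (auto simp: pre_def)
    then show False using V(2) by (auto simp: \<W>_def)
  qed
  define F where "F p = (SOME x. L p x)" for p
  have F: "L p (F p)" if "ultrafilter_on A p" for p
    unfolding F_def using ex[OF that] by (rule someI_ex)
  have disj: "pre U \<notin> p" if p: "ultrafilter_on A p" "pre V \<in> p" "U \<inter> V = {}" for p U V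
  proof
    assume "pre U \<in> p"
    then have "pre U \<inter> pre V \<in> p" using ultrafilter_onD(4)[OF p(1)] p(2) by blast
    moreover have "pre U \<inter> pre V = {}" using p(3) by (auto simp: pre_def)
    ultimately show False using ultrafilter_onD(3)[OF p(1)] by simp
  qed
  have "F (principal_ultrafilter A a) = f a" if a: "a \<in> A" for a
  proof (rule ccontr)
    let ?p = "principal_ultrafilter A a"
    assume ne: "F ?p \<noteq> f a"
    have up: "ultrafilter_on A ?p" using ultrafilter_on_principal[OF a] .
    have "F ?p \<in> topspace K" "f a \<in> topspace K" using F[OF up] f a by (auto simp: L_def)
    then obtain U V where UV: "openin K U" "openin K V" "F ?p \<in> U" "f a \<in> V" "disjnt U V"
      using K(2) ne unfolding Hausdorff_space_def by metis
    have "pre V \<in> ?p" using UV a by (auto simp: pre_def principal_ultrafilter_def)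
    moreover have "pre U \<in> ?p" using F[OF up] UV by (auto simp: L_def)
    ultimately show False using disj[OF up] UV(5) by (auto simp: disjnt_def)
  qed
  moreover have "continuous_map (stone_cech A) K F"
    unfolding continuous_map_def
  proof (intro conjI allI impI)
    show "F \<in> topspace (stone_cech A) \<rightarrow> topspace K"
      using F by (auto simp: topspace_stone_cech L_def)
    fix W assume W: "openin K W"
    show "openin (stone_cech A) {p \<in> topspace (stone_cech A). F p \<in> W}"
    proof (subst openin_subopen, intro ballI)
      fix p assume "p \<in> {p \<in> topspace (stone_cech A). F p \<in> W}"
      then have p: "ultrafilter_on A p" "F p \<in> W" by (auto simp: topspace_stone_cech)
      have "regular_space K" using K compact_Hausdorff_imp_regular_space by blast
      moreover have "closedin K (topspace K - W)" "F p \<in> topspace K - (topspace K - W)"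
        using W p(2) openin_subset[OF W] by auto
      ultimately obtain U V where UV: "openin K U" "openin K V" "F p \<in> U" "topspace K - W \<subseteq> V" "disjnt U V"
        unfolding regular_space_def by metis
      have "pre U \<in> p" using F[OF p(1)] UV by (auto simp: L_def)
      then have 1: "p \<in> ultra_basic A (pre U)" using p by (auto simp: ultra_basic_def)
      have "F q \<in> W" if "q \<in> ultra_basic A (pre U)" for q
      proof (rule ccontr)
        assume "F q \<notin> W"
        have q: "ultrafilter_on A q" "pre U \<in> q" using that by (auto simp: ultra_basic_def)
        then have "F q \<in> V" using F[OF q(1)] \<open>F q \<notin> W\<close> UV(4) by (auto simp: L_def)
        then have "pre V \<in> q" using F[OF q(1)] UV(2) by (auto simp: L_def)
        then show False using disj[OF q, of V] UV(5) by (auto simp: disjnt_def)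
      qed
      then have "ultra_basic A (pre U) \<subseteq> {p \<in> topspace (stone_cech A). F p \<in> W}"
        by (auto simp: ultra_basic_def topspace_stone_cech)
      moreover have "openin (stone_cech A) (ultra_basic A (pre U))"
        by (rule openin_ultra_basic) (auto simp: pre_def)
      ultimately show "\<exists>T. openin (stone_cech A) T \<and> p \<in> T \<and> T \<subseteq> {p \<in> topspace (stone_cech A). F p \<in> W}"
        using 1 by blast
    qed
  qed
  ultimately show ?thesis by blast
qed

section \<open>Equivariant asymptotic dimension of a group\<close>

definition stone_cech_action :: "('a, 'c) monoid_scheme \<Rightarrow> 'a \<Rightarrow> 'a set set \<Rightarrow> 'a set set" where
  "stone_cech_action G g = (\<lambda>p\<in>topspace (stone_cech (carrier G)). (\<lambda>B. g <#\<^bsub>G\<^esub> B) ` p)"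

lemma (in group) l_coset_image: "g <# B = (\<lambda>x. g \<otimes> x) ` B"
  by (auto simp: l_coset_def)

lemma (in group) ultrafilter_on_l_coset:
  assumes g: "g \<in> carrier G" and p: "ultrafilter_on (carrier G) p"
  shows "ultrafilter_on (carrier G) ((\<lambda>B. g <# B) ` p)"
    and "\<And>B. B \<subseteq> carrier G \<Longrightarrow> B \<in> (\<lambda>B. g <# B) ` p \<longleftrightarrow> inv g <# B \<in> p"
proof -
  show mem: "B \<in> (\<lambda>B. g <# B) ` p \<longleftrightarrow> inv g <# B \<in> p" if "B \<subseteq> carrier G" for B
  proof
    assume "B \<in> (\<lambda>B. g <# B) ` p"
    then obtain C where C: "C \<in> p" "B = g <# C" by blast
    then have "C \<subseteq> carrier G" using ultrafilter_onD(1)[OF p] by blast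
    then show "inv g <# B \<in> p" using C g by (simp add: lcos_m_assoc lcos_mult_one)
  next
    assume "inv g <# B \<in> p"
    moreover have "B = g <# (inv g <# B)" using that g by (simp add: lcos_m_assoc lcos_mult_one)
    ultimately show "B \<in> (\<lambda>B. g <# B) ` p" by blast
  qed
  have sub: "(\<lambda>B. g <# B) ` p \<subseteq> Pow (carrier G)"
    using ultrafilter_onD(1)[OF p] l_coset_subset_G[OF _ g] by blast
  have i: "inv g \<in> carrier G" using g by simp
  have inj: "inj_on (\<lambda>x. inv g \<otimes> x) (carrier G)" using i by (simp add: inj_on_def)
  have car: "inv g <# carrier G = carrier G" using i
    by (simp add: coset_join3 subgroup_self)
  show "ultrafilter_on (carrier G) ((\<lambda>B. g <# B) ` p)"
    unfolding ultrafilter_on_def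
  proof (intro conjI ballI allI impI)
    show "(\<lambda>B. g <# B) ` p \<subseteq> Pow (carrier G)" by (rule sub)
    show "carrier G \<in> (\<lambda>B. g <# B) ` p" using mem car ultrafilter_onD(2)[OF p] by simp
    show "{} \<notin> (\<lambda>B. g <# B) ` p" using mem[of "{}"] ultrafilter_onD(3)[OF p] by (simp add: l_coset_image)
    show "B \<inter> C \<in> (\<lambda>B. g <# B) ` p" if "B \<in> (\<lambda>B. g <# B) ` p" "C \<in> (\<lambda>B. g <# B) ` p" for B C
    proof -
      have BC: "B \<subseteq> carrier G" "C \<subseteq> carrier G" using that sub by auto
      then have "inv g <# (B \<inter> C) = (inv g <# B) \<inter> (inv g <# C)"
        unfolding l_coset_image by (rule inj_on_image_Int[OF inj])
      then show ?thesis
        using mem that BC ultrafilter_onD(4)[OF p] by (metis le_infI1)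
    qed
    show "C \<in> (\<lambda>B. g <# B) ` p" if "B \<in> (\<lambda>B. g <# B) ` p" "B \<subseteq> C \<and> C \<subseteq> carrier G" for B C
    proof -
      have "inv g <# B \<in> p" using mem that by blast
      moreover have "inv g <# B \<subseteq> inv g <# C" using that by (auto simp: l_coset_image)
      moreover have "inv g <# C \<subseteq> carrier G" using that i l_coset_subset_G by blast
      ultimately show ?thesis using mem that ultrafilter_onD(5)[OF p] by blast
    qed
    show "B \<in> (\<lambda>B. g <# B) ` p \<or> carrier G - B \<in> (\<lambda>B. g <# B) ` p" if B: "B \<subseteq> carrier G" for B
    proof -
      have "inv g <# (carrier G - B) = carrier G - (inv g <# B)"
        using inj_on_image_set_diff[OF inj, of "carrier G" B] B car unfolding l_coset_image by auto
      then show ?thesis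
        using mem[OF B] mem[of "carrier G - B"] ultrafilter_onD(6)[OF p, of "inv g <# B"]
          l_coset_subset_G[OF B i] by auto
    qed
  qed
qed

lemma (in group) compact_G_space_stone_cech:
  "compact_G_space G (stone_cech (carrier G)) (stone_cech_action G)"
proof -
  let ?X = "stone_cech (carrier G)" and ?\<phi> = "stone_cech_action G"
  have closed: "?\<phi> g p \<in> topspace ?X" if "g \<in> carrier G" "p \<in> topspace ?X" for g p
    using that ultrafilter_on_l_coset(1) by (simp add: stone_cech_action_def topspace_stone_cech)
  have comp: "?\<phi> (g \<otimes> h) p = ?\<phi> g (?\<phi> h p)"
    if gh: "g \<in> carrier G" "h \<in> carrier G" and p: "p \<in> topspace ?X" for g h p
  proof -
    have "(g \<otimes> h) <# B = g <# (h <# B)" if "B \<in> p" for B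
      using lcos_m_assoc[OF _ gh] ultrafilter_onD(1)[OF _ that] p by (simp add: topspace_stone_cech)
    then show ?thesis
      using closed[OF gh(2) p] p by (simp add: stone_cech_action_def image_image cong: image_cong)
  qed
  have one: "?\<phi> \<one> p = p" if p: "p \<in> topspace ?X" for p
  proof -
    have "\<one> <# B = B" if "B \<in> p" for B
      using lcos_mult_one ultrafilter_onD(1)[OF _ that] p by (simp add: topspace_stone_cech)
    then show ?thesis using p by (simp add: stone_cech_action_def cong: image_cong)
  qed
  have inv1: "?\<phi> (inv g) (?\<phi> g p) = p" and inv2: "?\<phi> g (?\<phi> (inv g) p) = p"
    if "g \<in> carrier G" "p \<in> topspace ?X" for g p
    using that comp[of "inv g" g p] comp[of g "inv g" p] one by auto
  have bij: "?\<phi> g \<in> Bij (topspace ?X)" if g: "g \<in> carrier G" for g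
  proof -
    have "bij_betw (?\<phi> g) (topspace ?X) (topspace ?X)"
      using g closed inv1 inv2 by (intro bij_betw_byWitness[where f' = "?\<phi> (inv g)"]) auto
    then show ?thesis by (simp add: Bij_def stone_cech_action_def)
  qed
  have "group_action G (topspace ?X) ?\<phi>"
  proof (unfold group_action_def group_hom_def group_hom_axioms_def, intro conjI)
    show "?\<phi> \<in> hom G (BijGroup (topspace ?X))"
    proof (rule homI)
      show "?\<phi> g \<in> carrier (BijGroup (topspace ?X))" if "g \<in> carrier G" for g
        using bij[OF that] by (simp add: BijGroup_def)
      show "?\<phi> (g \<otimes> h) = ?\<phi> g \<otimes>\<^bsub>BijGroup (topspace ?X)\<^esub> ?\<phi> h"
        if "g \<in> carrier G" "h \<in> carrier G" for g h
      proof
        fix p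
        show "?\<phi> (g \<otimes> h) p = (?\<phi> g \<otimes>\<^bsub>BijGroup (topspace ?X)\<^esub> ?\<phi> h) p"
          using bij that comp[OF that, of p]
          by (cases "p \<in> topspace ?X") (simp_all add: BijGroup_def compose_def stone_cech_action_def)
      qed
    qed
  qed (use is_group group_BijGroup in auto)
  moreover have cont: "continuous_map ?X ?X (?\<phi> g)" if g: "g \<in> carrier G" for g
  proof -
    have "openin ?X (?\<phi> g -` ultra_basic (carrier G) B \<inter> topspace ?X)" if B: "B \<subseteq> carrier G" for B
    proof -
      have "?\<phi> g -` ultra_basic (carrier G) B \<inter> topspace ?X = ultra_basic (carrier G) (inv g <# B)"
        using ultrafilter_on_l_coset[OF g] B
        by (auto simp: ultra_basic_def topspace_stone_cech stone_cech_action_def)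
      moreover have "inv g <# B \<subseteq> carrier G" using l_coset_subset_G[OF B] g by simp
      ultimately show ?thesis by (simp add: openin_ultra_basic)
    qed
    moreover have "?\<phi> g ` topspace ?X \<subseteq> \<Union>(ultra_basic (carrier G) ` Pow (carrier G))"
      using closed[OF g] by (auto simp: topspace_stone_cech ultra_basic_def dest: ultrafilter_onD(2))
    ultimately have "continuous_map ?X (topology_generated_by (ultra_basic (carrier G) ` Pow (carrier G))) (?\<phi> g)"
      by (intro continuous_on_generated_topo) auto
    then show ?thesis by (simp add: stone_cech_def)
  qed
  moreover have "homeomorphic_map ?X ?X (?\<phi> g)" if g: "g \<in> carrier G" for g
    using cont[OF g] cont[of "inv g"] g inv1 inv2
    by (intro homeomorphic_maps_imp_map[of _ _ _ "?\<phi> (inv g)"]) (simp add: homeomorphic_maps_def)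
  ultimately show ?thesis
    using compact_space_stone_cech unfolding compact_G_space_def by blast
qed

lemma (in group) stone_cech_action_principal:
  assumes "g \<in> carrier G" "a \<in> carrier G"
  shows "stone_cech_action G g (principal_ultrafilter (carrier G) a) = principal_ultrafilter (carrier G) (g \<otimes> a)"
proof -
  let ?p = "principal_ultrafilter (carrier G) a"
  have up: "ultrafilter_on (carrier G) ?p" by (rule ultrafilter_on_principal[OF assms(2)])
  have mem: "B \<in> (\<lambda>B. g <# B) ` ?p \<longleftrightarrow> B \<in> principal_ultrafilter (carrier G) (g \<otimes> a)" for B
  proof (cases "B \<subseteq> carrier G")
    case True
    have "a \<in> inv g <# B \<longleftrightarrow> g \<otimes> a \<in> B"
    proof
      assume "a \<in> inv g <# B"
      then obtain b where "b \<in> B" "a = inv g \<otimes> b" by (auto simp: l_coset_image)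
      then show "g \<otimes> a \<in> B" using assms True by (auto simp: m_assoc[symmetric])
    next
      assume "g \<otimes> a \<in> B"
      moreover have "a = inv g \<otimes> (g \<otimes> a)" using assms by (simp add: m_assoc[symmetric])
      ultimately show "a \<in> inv g <# B" by (auto simp: l_coset_image)
    qed
    moreover have "inv g <# B \<subseteq> carrier G" using True assms by (simp add: l_coset_subset_G)
    ultimately show ?thesis
      using ultrafilter_on_l_coset(2)[OF assms(1) up True] True by (simp add: principal_ultrafilter_def)
  next
    case False
    then have "B \<notin> (\<lambda>B. g <# B) ` ?p"
      using ultrafilter_onD(1)[OF ultrafilter_on_l_coset(1)[OF assms(1) up]] by metis
    with False show ?thesis by (simp add: principal_ultrafilter_def)
  qed
  have "(\<lambda>B. g <# B) ` ?p = principal_ultrafilter (carrier G) (g \<otimes> a)" by (rule Set.set_eqI[OF mem])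
  then show ?thesis using up by (simp add: stone_cech_action_def topspace_stone_cech)
qed

definition group_eq_asdim :: "('a, 'c) monoid_scheme \<Rightarrow> 'a set \<Rightarrow> 'a set set \<Rightarrow> ereal" where
  "group_eq_asdim G S \<F> = eq_asdim G S \<F> (stone_cech (carrier G)) (stone_cech_action G)"

end

theory Submission
  imports Defs
begin

text \<open>
  A cover of dimension at most \<open>0\<close> consists of pairwise disjoint sets.  If such a
  cover \<open>\<U>\<close> of \<open>G \<times> X\<close> has a \<open>G\<close>-Lebesgue number \<open>\<alpha> \<ge> 1\<close>, then the member of \<open>\<U>\<close> through
  \<open>(g, y)\<close> also contains \<open>(g s, y)\<close> for every generator \<open>s\<close>; as the Cayley graph is connected, it
  contains all of \<open>G \<times> {y}\<close>.  So every member of \<open>\<U>\<close> is a slab \<open>G \<times> V\<close>, and conversely a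
  cover by slabs has every \<open>\<alpha>\<close> as a Lebesgue number.  Hence the equivariant asymptotic dimension of
  \<open>G \<times> X\<close> is at most \<open>0\<close> precisely when \<open>X\<close> itself has an open \<open>\<F>\<close>-cover by pairwise disjoint
  sets (\<open>eq_asdim_le_0_iff\<close>).

  If \<open>X\<close> is nonempty and compact, such a partition of \<open>X\<close> has only finitely many nonempty members.
  As \<open>G\<close> permutes them, the stabiliser of any one of them has finite index, and it belongs to
  \<open>\<F>\<close> (\<open>finite_index_if_open_partition\<close>).  If conversely \<open>H\<close> is a finite-index member of
  \<open>\<F>\<close>, the finite partition of \<open>G\<close> into the left cosets of \<open>H\<close> extends to a clopen partition of the
  Stone-Cech compactification, since an ultrafilter contains exactly one block of a finite
  partition; the stabiliser of \<open>g H\<close> is the conjugate \<open>g H g\<^sup>-\<^sup>1\<close>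
  (\<open>stone_cech_open_partition\<close>).
\<close>

section \<open>Disjoint covers and slabs\<close>

lemma pairwise_disjnt_eqI:
  assumes "pairwise disjnt \<U>" "U \<in> \<U>" "U' \<in> \<U>" "y \<in> U" "y \<in> U'"
  shows "U = U'"
  using assms by (auto simp: pairwise_def disjnt_iff)

lemma cover_dim_le_0_iff:
  assumes "\<Union>\<U> = Y"
  shows "cover_dim Y \<U> \<le> 0 \<longleftrightarrow> pairwise disjnt \<U>"
proof -
  define m where "m y = (let \<V> = {U \<in> \<U>. y \<in> U} in if finite \<V> then enat (card \<V>) else \<infinity>)" for y
  have m: "m y \<le> 1 \<longleftrightarrow> (\<forall>U\<in>\<U>. \<forall>U'\<in>\<U>. y \<in> U \<longrightarrow> y \<in> U' \<longrightarrow> U = U')" for y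
  proof -
    have "m y \<le> 1 \<longleftrightarrow> finite {U \<in> \<U>. y \<in> U} \<and> card {U \<in> \<U>. y \<in> U} \<le> Suc 0"
      by (auto simp: m_def Let_def one_enat_def)
    also have "\<dots> \<longleftrightarrow> (\<forall>U\<in>\<U>. \<forall>U'\<in>\<U>. y \<in> U \<longrightarrow> y \<in> U' \<longrightarrow> U = U')"
    proof
      assume *: "\<forall>U\<in>\<U>. \<forall>U'\<in>\<U>. y \<in> U \<longrightarrow> y \<in> U' \<longrightarrow> U = U'"
      have "\<exists>W. {U \<in> \<U>. y \<in> U} \<subseteq> {W}"
        using * by blast
      then have "finite {U \<in> \<U>. y \<in> U}"
        by (meson finite.simps finite_subset)
      then show "finite {U \<in> \<U>. y \<in> U} \<and> card {U \<in> \<U>. y \<in> U} \<le> Suc 0"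
        using * by (simp add: card_le_Suc0_iff_eq)
    next
      assume "finite {U \<in> \<U>. y \<in> U} \<and> card {U \<in> \<U>. y \<in> U} \<le> Suc 0"
      then have "\<forall>U\<in>{U \<in> \<U>. y \<in> U}. \<forall>U'\<in>{U \<in> \<U>. y \<in> U}. U = U'"
        using card_le_Suc0_iff_eq by blast
      then show "\<forall>U\<in>\<U>. \<forall>U'\<in>\<U>. y \<in> U \<longrightarrow> y \<in> U' \<longrightarrow> U = U'"
        by blast
    qed
    finally show ?thesis .
  qed
  have shift: "ereal_of_enat x - 1 \<le> 0 \<longleftrightarrow> x \<le> 1" for x
    by (cases x) (auto simp: one_enat_def one_ereal_def zero_ereal_def)
  have "cover_dim Y \<U> \<le> 0 \<longleftrightarrow> (\<forall>y\<in>Y. m y \<le> 1)"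
    unfolding cover_dim_def shift m_def[symmetric] by (rule SUP_le_iff)
  also have "\<dots> \<longleftrightarrow> pairwise disjnt \<U>"
    unfolding m pairwise_def disjnt_iff using assms by blast
  finally show ?thesis .
qed

lemma cover_dim_nonneg:
  assumes "\<Union>\<U> = Y" "Y \<noteq> {}"
  shows "0 \<le> cover_dim Y \<U>"
proof -
  obtain y U where y: "y \<in> Y" "U \<in> \<U>" "y \<in> U"
    using assms by blast
  define m where "m y = (let \<V> = {U \<in> \<U>. y \<in> U} in if finite \<V> then enat (card \<V>) else \<infinity>)" for y
  have "1 \<le> m y"
    using y by (auto simp: m_def Let_def one_enat_def Suc_le_eq card_gt_0_iff)
  also have "\<dots> \<le> (SUP y\<in>Y. m y)"
    using y(1) by (rule SUP_upper)
  finally have "ereal_of_enat 1 \<le> ereal_of_enat (SUP y\<in>Y. m y)"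
    by simp
  then show ?thesis
    unfolding cover_dim_def m_def[symmetric]
    by (cases "ereal_of_enat (SUP y\<in>Y. m y)") (auto simp: one_ereal_def one_enat_def)
qed

lemma Times_eq_cancel: "A \<noteq> {} \<Longrightarrow> A \<times> V = A \<times> W \<longleftrightarrow> V = W"
  by (auto simp: times_eq_iff)

context group
begin

text \<open>
  Left multiplication permutes the factor \<open>G\<close>, so the diagonal action moves a slab \<open>G \<times> V\<close> exactly
  as the given action moves \<open>V\<close>.  Disjointness of translates, stabilisers and invariance therefore
  transfer between \<open>V\<close> and its slab.
\<close>

lemma diagonal_action_image_slab:
  assumes "h \<in> carrier G" "V \<subseteq> E"
  shows "diagonal_action G E \<phi> h ` (carrier G \<times> V) = carrier G \<times> \<phi> h ` V"
proof
  show "carrier G \<times> \<phi> h ` V \<subseteq> diagonal_action G E \<phi> h ` (carrier G \<times> V)"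
  proof clarify
    fix g v assume gv: "g \<in> carrier G" "v \<in> V"
    have "(g, \<phi> h v) = diagonal_action G E \<phi> h (inv h \<otimes> g, v)"
      using assms gv by (auto simp: diagonal_action_def m_assoc[symmetric])
    then show "(g, \<phi> h v) \<in> diagonal_action G E \<phi> h ` (carrier G \<times> V)"
      using assms gv by blast
  qed
qed (use assms in \<open>auto simp: diagonal_action_def subset_iff\<close>)

lemma F_subset_slab:
  assumes "V \<subseteq> E"
  shows "F_subset G \<F> (carrier G \<times> E) (diagonal_action G E \<phi>) (carrier G \<times> V)
    \<longleftrightarrow> F_subset G \<F> E \<phi> V"
proof -
  have ne: "carrier G \<noteq> {}"
    using one_closed by blast
  have "stabilizer G (\<lambda>g. (`) (diagonal_action G E \<phi> g)) (carrier G \<times> V)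
      = stabilizer G (\<lambda>g. (`) (\<phi> g)) V"
    unfolding stabilizer_def
    by (intro Collect_cong conj_cong refl)
      (simp add: diagonal_action_image_slab[OF _ assms] Times_eq_cancel[OF ne])
  moreover have "carrier G \<times> V \<subseteq> carrier G \<times> E"
    using assms by blast
  moreover have "(carrier G \<times> \<phi> g ` V) \<inter> (carrier G \<times> \<phi> g' ` V) = {} \<longleftrightarrow> \<phi> g ` V \<inter> \<phi> g' ` V = {}" for g g'
    using ne by blast
  ultimately show ?thesis
    using assms
    by (simp add: F_subset_def diagonal_action_image_slab Times_eq_cancel[OF ne])
qed

lemma F_cover_slabs:
  assumes "\<V> \<subseteq> Pow E"
  shows "F_cover G \<F> (carrier G \<times> E) (diagonal_action G E \<phi>) ((\<times>) (carrier G) ` \<V>)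
    \<longleftrightarrow> F_cover G \<F> E \<phi> \<V>"
proof -
  have ne: "carrier G \<noteq> {}"
    using one_closed by blast
  have "\<Union> ((\<times>) (carrier G) ` \<V>) = carrier G \<times> \<Union>\<V>"
    by blast
  moreover have "(\<forall>V\<in>\<V>. F_subset G \<F> (carrier G \<times> E) (diagonal_action G E \<phi>) (carrier G \<times> V))
      \<longleftrightarrow> (\<forall>V\<in>\<V>. F_subset G \<F> E \<phi> V)"
    using assms F_subset_slab by blast
  moreover have "diagonal_action G E \<phi> g ` (carrier G \<times> V) \<in> (\<times>) (carrier G) ` \<V> \<longleftrightarrow> \<phi> g ` V \<in> \<V>"
    if "V \<in> \<V>" "g \<in> carrier G" for V g
  proof -
    have "V \<subseteq> E"
      using that assms by blast
    then show ?thesis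
      using that by (auto simp: diagonal_action_image_slab Times_eq_cancel[OF ne])
  qed
  ultimately show ?thesis
    by (simp add: F_cover_def Times_eq_cancel[OF ne])
qed

section \<open>Connectedness of the Cayley graph\<close>

lemma word_cball_self:
  assumes "g \<in> carrier G" "0 \<le> \<alpha>"
  shows "g \<in> word_cball G S g \<alpha>"
proof -
  have "word_length G S \<one> \<le> 0"
    unfolding word_length_def by (rule Least_le) simp
  then show ?thesis
    using assms by (simp add: word_cball_def word_dist_def)
qed

lemma word_cball_generator:
  assumes "g \<in> carrier G" "S \<subseteq> carrier G" "s \<in> S \<union> m_inv G ` S" "1 \<le> \<alpha>"
  shows "g \<otimes> s \<in> word_cball G S g \<alpha>"
proof -
  have s: "s \<in> carrier G"
    using assms by auto
  have "word_length G S s \<le> 1"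
    unfolding word_length_def using assms s by (intro Least_le exI[of _ "[s]"]) auto
  then have "word_dist G S g (g \<otimes> s) \<le> 1"
    using assms s by (simp add: word_dist_def m_assoc[symmetric])
  then show ?thesis
    using assms s by (simp add: word_cball_def)
qed

text \<open>
  By disjointness the member that contains a ball around \<open>(g, y)\<close> is the one already known to
  contain \<open>(g, y)\<close>; so membership propagates along the edges of the Cayley graph.
\<close>

lemma Lebesgue_disjoint_cover_contains_fibre:
  assumes S: "S \<subseteq> carrier G" "generate G S = carrier G"
    and \<U>: "pairwise disjnt \<U>" "G_Lebesgue_number G S Y \<U> \<alpha>" "1 \<le> \<alpha>"
    and U: "U \<in> \<U>" "(g, y) \<in> U" "g \<in> carrier G" "y \<in> Y"
  shows "carrier G \<times> {y} \<subseteq> U"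
proof -
  have step: "(k \<otimes> s, y) \<in> U" if k: "k \<in> carrier G" "(k, y) \<in> U" and s: "s \<in> S \<union> m_inv G ` S" for k s
  proof -
    obtain U' where U': "U' \<in> \<U>" "word_cball G S k \<alpha> \<times> {y} \<subseteq> U'"
      using \<U>(2) k U(4) unfolding G_Lebesgue_number_def by blast
    have "(k, y) \<in> U'"
      using word_cball_self[OF k(1)] \<U>(3) U'(2) by auto
    then have "U' = U"
      using pairwise_disjnt_eqI[OF \<U>(1) U'(1) U(1)] k(2) by blast
    then show ?thesis
      using word_cball_generator[OF k(1) S(1) s \<U>(3)] U'(2) by blast
  qed
  have walk: "\<forall>k\<in>carrier G. (k, y) \<in> U \<longrightarrow> (k \<otimes> h, y) \<in> U" if "h \<in> generate G S" for h
    using that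
  proof induction
    case (eng h1 h2)
    then show ?case
      using S generate_in_carrier[OF S(1)] by (metis m_assoc m_closed)
  qed (use step in auto)
  show ?thesis
  proof clarify
    fix k assume k: "k \<in> carrier G"
    have "(g \<otimes> (inv g \<otimes> k), y) \<in> U"
      using walk[of "inv g \<otimes> k"] S(2) U k by simp
    then show "(k, y) \<in> U"
      using U k by (simp add: m_assoc[symmetric])
  qed
qed

section \<open>Dimension at most zero means an open partition\<close>

lemma open_partition_if_disjoint_cover:
  assumes S: "S \<subseteq> carrier G" "generate G S = carrier G"
    and cov: "F_cover G \<F> (carrier G \<times> topspace X) (diagonal_action G (topspace X) \<phi>) \<U>"
    and op: "\<forall>U\<in>\<U>. openin (prod_topology (discrete_topology (carrier G)) X) U"
    and disj: "pairwise disjnt \<U>"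
    and Leb: "G_Lebesgue_number G S (topspace X) \<U> \<alpha>" "1 \<le> \<alpha>"
  shows "\<exists>\<V>. F_cover G \<F> (topspace X) \<phi> \<V> \<and> (\<forall>V\<in>\<V>. openin X V) \<and> pairwise disjnt \<V>"
proof -
  have ne: "carrier G \<noteq> {}"
    using one_closed by blast
  define \<V> where "\<V> = {V. V \<subseteq> topspace X \<and> carrier G \<times> V \<in> \<U>}"
  have "U \<in> (\<times>) (carrier G) ` \<V>" if U: "U \<in> \<U>" for U
  proof -
    have sub: "U \<subseteq> carrier G \<times> topspace X"
      using U cov by (auto simp: F_cover_def)
    then have "carrier G \<times> {y} \<subseteq> U" if "(g, y) \<in> U" for g y
      using that Lebesgue_disjoint_cover_contains_fibre[OF S disj Leb U] by blast
    with sub have slab: "U = carrier G \<times> snd ` U"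
      by force
    have "snd ` U \<in> \<V>"
      using sub U by (auto simp: \<V>_def slab[symmetric])
    with slab show ?thesis
      by blast
  qed
  moreover have "(\<times>) (carrier G) ` \<V> \<subseteq> \<U>"
    by (auto simp: \<V>_def)
  ultimately have eq: "\<U> = (\<times>) (carrier G) ` \<V>"
    by blast
  have "F_cover G \<F> (topspace X) \<phi> \<V>"
    using cov F_cover_slabs[of \<V> "topspace X"] unfolding eq by (auto simp: \<V>_def)
  moreover have "openin X V" if "V \<in> \<V>" for V
    using that op ne by (auto simp: eq openin_prod_Times_iff)
  moreover have "pairwise disjnt \<V>"
    using disj ne by (auto simp: eq pairwise_def disjnt_iff Times_eq_cancel[OF ne])
  ultimately show ?thesis
    by blast
qed

text \<open>
  A slab contains \<open>B \<times> {y}\<close> for every \<open>B \<subseteq> G\<close> as soon as it contains one point over \<open>y\<close>, whence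
  the Lebesgue condition for arbitrary \<open>\<alpha>\<close>.
\<close>

lemma disjoint_cover_if_open_partition:
  assumes cov: "F_cover G \<F> (topspace X) \<phi> \<V>"
    and op: "\<forall>V\<in>\<V>. openin X V"
    and disj: "pairwise disjnt \<V>"
  defines "\<U> \<equiv> (\<times>) (carrier G) ` \<V>"
  shows "F_cover G \<F> (carrier G \<times> topspace X) (diagonal_action G (topspace X) \<phi>) \<U>"
    and "\<forall>U\<in>\<U>. openin (prod_topology (discrete_topology (carrier G)) X) U"
    and "pairwise disjnt \<U>"
    and "G_Lebesgue_number G S (topspace X) \<U> \<alpha>"
proof -
  have "\<V> \<subseteq> Pow (topspace X)"
    using cov by (auto simp: F_cover_def)
  then show "F_cover G \<F> (carrier G \<times> topspace X) (diagonal_action G (topspace X) \<phi>) \<U>"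
    using cov F_cover_slabs unfolding \<U>_def by blast
  show "\<forall>U\<in>\<U>. openin (prod_topology (discrete_topology (carrier G)) X) U"
    using op by (auto simp: \<U>_def openin_prod_Times_iff)
  show "pairwise disjnt \<U>"
    using disj by (auto simp: \<U>_def pairwise_def disjnt_iff)
  show "G_Lebesgue_number G S (topspace X) \<U> \<alpha>"
    unfolding G_Lebesgue_number_def
  proof (intro ballI)
    fix g y assume "g \<in> carrier G" "y \<in> topspace X"
    then have "y \<in> \<Union>\<V>"
      using cov by (simp add: F_cover_def)
    then obtain V where "V \<in> \<V>" "y \<in> V"
      by blast
    then show "\<exists>U\<in>\<U>. word_cball G S g \<alpha> \<times> {y} \<subseteq> U"
      by (auto simp: \<U>_def word_cball_def)
  qed
qed

theorem eq_asdim_le_0_iff: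
  assumes S: "S \<subseteq> carrier G" "generate G S = carrier G"
  shows "eq_asdim G S \<F> X \<phi> \<le> 0
    \<longleftrightarrow> (\<exists>\<V>. F_cover G \<F> (topspace X) \<phi> \<V> \<and> (\<forall>V\<in>\<V>. openin X V) \<and> pairwise disjnt \<V>)"
proof
  assume "eq_asdim G S \<F> X \<phi> \<le> 0"
  then have "eq_asdim G S \<F> X \<phi> < 1"
    by (rule order.strict_trans1) simp
  \<comment> \<open>The infimum ranges over integers, so a value below \<open>1\<close> is witnessed by some \<open>n \<le> 0\<close>.\<close>
  then obtain n :: int where n: "ereal (of_int n) < 1"
    "\<forall>\<alpha>::real. \<exists>\<U>.
        F_cover G \<F> (carrier G \<times> topspace X) (diagonal_action G (topspace X) \<phi>) \<U> \<and>
        (\<forall>U\<in>\<U>. openin (prod_topology (discrete_topology (carrier G)) X) U) \<and>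
        cover_dim (carrier G \<times> topspace X) \<U> \<le> ereal (of_int n) \<and>
        G_Lebesgue_number G S (topspace X) \<U> \<alpha>"
    unfolding eq_asdim_def Inf_less_iff by blast
  obtain \<U> where \<U>: "F_cover G \<F> (carrier G \<times> topspace X) (diagonal_action G (topspace X) \<phi>) \<U>"
      "\<forall>U\<in>\<U>. openin (prod_topology (discrete_topology (carrier G)) X) U"
      "cover_dim (carrier G \<times> topspace X) \<U> \<le> ereal (of_int n)"
      "G_Lebesgue_number G S (topspace X) \<U> 1"
    using n(2) by blast
  have "ereal (of_int n) \<le> 0"
    using n(1) by (simp add: one_ereal_def)
  with \<U>(3) have "cover_dim (carrier G \<times> topspace X) \<U> \<le> 0"
    by (rule order.trans)
  moreover have "\<Union>\<U> = carrier G \<times> topspace X"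
    using \<U>(1) by (simp add: F_cover_def)
  ultimately have "pairwise disjnt \<U>"
    using cover_dim_le_0_iff by blast
  then show "\<exists>\<V>. F_cover G \<F> (topspace X) \<phi> \<V> \<and> (\<forall>V\<in>\<V>. openin X V) \<and> pairwise disjnt \<V>"
    using open_partition_if_disjoint_cover[OF S \<U>(1,2) _ \<U>(4)] by simp
next
  assume "\<exists>\<V>. F_cover G \<F> (topspace X) \<phi> \<V> \<and> (\<forall>V\<in>\<V>. openin X V) \<and> pairwise disjnt \<V>"
  then obtain \<V> where \<V>: "F_cover G \<F> (topspace X) \<phi> \<V>" "\<forall>V\<in>\<V>. openin X V" "pairwise disjnt \<V>"
    by blast
  note slabs = disjoint_cover_if_open_partition[OF \<V>]
  have "\<Union>((\<times>) (carrier G) ` \<V>) = carrier G \<times> topspace X"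
    using slabs(1) by (simp add: F_cover_def)
  then have "cover_dim (carrier G \<times> topspace X) ((\<times>) (carrier G) ` \<V>) \<le> ereal (of_int 0)"
    using cover_dim_le_0_iff slabs(3) by (metis of_int_0 zero_ereal_def)
  then have "eq_asdim G S \<F> X \<phi> \<le> ereal (of_int 0)"
    unfolding eq_asdim_def using slabs(1,2,4) by (intro Inf_lower) blast
  then show "eq_asdim G S \<F> X \<phi> \<le> 0"
    by (simp add: zero_ereal_def)
qed

lemma eq_asdim_nonneg:
  assumes "topspace X \<noteq> {}"
  shows "0 \<le> eq_asdim G S \<F> X \<phi>"
  unfolding eq_asdim_def
proof (rule Inf_greatest, clarify)
  fix n :: int
  assume "\<forall>\<alpha>::real. \<exists>\<U>.
        F_cover G \<F> (carrier G \<times> topspace X) (diagonal_action G (topspace X) \<phi>) \<U> \<and>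
        (\<forall>U\<in>\<U>. openin (prod_topology (discrete_topology (carrier G)) X) U) \<and>
        cover_dim (carrier G \<times> topspace X) \<U> \<le> ereal (of_int n) \<and>
        G_Lebesgue_number G S (topspace X) \<U> \<alpha>"
  then obtain \<U> where "F_cover G \<F> (carrier G \<times> topspace X) (diagonal_action G (topspace X) \<phi>) \<U>"
      and dim: "cover_dim (carrier G \<times> topspace X) \<U> \<le> ereal (of_int n)"
    by blast
  then have "\<Union>\<U> = carrier G \<times> topspace X"
    by (simp add: F_cover_def)
  moreover have "carrier G \<times> topspace X \<noteq> {}"
    using assms one_closed by blast
  ultimately show "0 \<le> ereal (of_int n)"
    using cover_dim_nonneg dim by (metis order.trans)
qed

end

section \<open>From an open partition to a finite-index subgroup\<close>

text \<open>
  Discarding a nonempty member of a disjoint cover leaves its points uncovered, so a finite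
  subcover already has all nonempty members.
\<close>

lemma compact_space_finite_open_partition:
  assumes "compact_space X" "\<Union>\<V> = topspace X" "\<forall>V\<in>\<V>. openin X V" "pairwise disjnt \<V>"
  shows "finite \<V>"
proof -
  obtain \<V>' where \<V>': "finite \<V>'" "\<V>' \<subseteq> \<V>" "\<Union>\<V>' = topspace X"
    using assms(1-3) unfolding compact_space by metis
  have "\<V> \<subseteq> insert {} \<V>'"
  proof
    fix V assume V: "V \<in> \<V>"
    show "V \<in> insert {} \<V>'"
    proof (cases "V = {}")
      case False
      then obtain y where y: "y \<in> V"
        by blast
      then obtain V' where "V' \<in> \<V>'" "y \<in> V'"
        using V assms(2) \<V>'(3) by blast
      then show ?thesis
        using pairwise_disjnt_eqI[OF assms(4) V _ y] \<V>'(2) by blast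
    qed simp
  qed
  then show ?thesis
    using \<V>'(1) finite_subset by blast
qed

text \<open>
  The orbit-stabiliser correspondence for the induced action on subsets.  Counting right cosets
  instead of left ones costs an inversion: the right coset of \<open>g\<close> corresponds to the translate of
  \<open>V\<close> by \<open>g\<^sup>-\<^sup>1\<close>.
\<close>

lemma (in group_action) finite_orbit_imp_finite_index_stabilizer:
  assumes sub: "subgroup (stabilizer G (\<lambda>g. (`) (\<phi> g)) V) G"
    and V: "V \<subseteq> E" and fin: "finite ((\<lambda>g. \<phi> g ` V) ` carrier G)"
  shows "finite (rcosets (stabilizer G (\<lambda>g. (`) (\<phi> g)) V))"
proof -
  interpret group G
    using group_hom group_hom.axioms(1) by blast
  let ?K = "stabilizer G (\<lambda>g. (`) (\<phi> g)) V"
  have comp: "\<phi> (g \<otimes> h) ` V = \<phi> g ` \<phi> h ` V" if "g \<in> carrier G" "h \<in> carrier G" for g h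
    unfolding image_image using that V composition_rule by (intro image_cong) auto
  have one: "\<phi> \<one> ` V = V"
    using V id_eq_one[symmetric] by (auto simp: image_iff subset_iff)
  have coset: "?K #> g = ?K #> h"
    if g: "g \<in> carrier G" and h: "h \<in> carrier G" and eq: "\<phi> (inv g) ` V = \<phi> (inv h) ` V" for g h
  proof -
    have "\<phi> (h \<otimes> inv g) ` V = V"
      using comp[of h "inv g"] comp[of h "inv h"] g h eq one by simp
    then have "h \<otimes> inv g \<in> ?K"
      using g h by (simp add: stabilizer_def)
    moreover have "h = h \<otimes> inv g \<otimes> g"
      using g h by (simp add: m_assoc)
    ultimately have "h \<in> ?K #> g"
      unfolding r_coset_def by blast
    then show ?thesis
      using repr_independence g sub by blast
  qed
  define t where "t W = ?K #> (SOME g. g \<in> carrier G \<and> \<phi> (inv g) ` V = W)" for W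
  have "?K #> g = t (\<phi> (inv g) ` V)" if g: "g \<in> carrier G" for g
  proof -
    let ?h = "SOME h. h \<in> carrier G \<and> \<phi> (inv h) ` V = \<phi> (inv g) ` V"
    have h: "?h \<in> carrier G \<and> \<phi> (inv ?h) ` V = \<phi> (inv g) ` V"
      by (rule someI[of _ g]) (use g in simp)
    show ?thesis
      unfolding t_def using coset[OF g conjunct1[OF h] conjunct2[OF h, symmetric]] .
  qed
  then have "rcosets ?K \<subseteq> t ` (\<lambda>g. \<phi> g ` V) ` carrier G"
    by (auto simp: RCOSETS_def)
  then show ?thesis
    using fin finite_subset by blast
qed

lemma (in group) finite_index_if_open_partition:
  assumes fam: "subgroup_family G \<F>"
    and X: "compact_G_space G X \<phi>" "topspace X \<noteq> {}"
    and cov: "F_cover G \<F> (topspace X) \<phi> \<V>"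
    and op: "\<forall>V\<in>\<V>. openin X V" and disj: "pairwise disjnt \<V>"
  shows "\<exists>H\<in>\<F>. finite (rcosets H)"
proof -
  interpret group_action G "topspace X" \<phi>
    using X(1) by (simp add: compact_G_space_def)
  have "finite \<V>"
    using X(1) cov op disj
    by (intro compact_space_finite_open_partition) (auto simp: compact_G_space_def F_cover_def)
  have "\<Union>\<V> \<noteq> {}"
    using X(2) cov by (simp add: F_cover_def)
  then obtain V where V: "V \<in> \<V>"
    by blast
  then have mem: "stabilizer G (\<lambda>g. (`) (\<phi> g)) V \<in> \<F>" and "V \<subseteq> topspace X"
    using cov by (auto simp: F_cover_def F_subset_def)
  moreover have "(\<lambda>g. \<phi> g ` V) ` carrier G \<subseteq> \<V>"
    using V cov by (auto simp: F_cover_def)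
  then have "finite ((\<lambda>g. \<phi> g ` V) ` carrier G)"
    using \<open>finite \<V>\<close> by (rule finite_subset)
  moreover have "subgroup (stabilizer G (\<lambda>g. (`) (\<phi> g)) V) G"
    using fam mem by (simp add: subgroup_family_def)
  ultimately have "finite (rcosets (stabilizer G (\<lambda>g. (`) (\<phi> g)) V))"
    by (intro finite_orbit_imp_finite_index_stabilizer)
  with mem show ?thesis
    by blast
qed

section \<open>From a finite-index subgroup to an open partition\<close>

lemma inj_on_ultra_basic: "inj_on (ultra_basic A) (Pow A)"
proof (rule inj_onI)
  fix B C assume BC: "B \<in> Pow A" "C \<in> Pow A" "ultra_basic A B = ultra_basic A C"
  have "a \<in> B \<longleftrightarrow> principal_ultrafilter A a \<in> ultra_basic A B"
    and "a \<in> C \<longleftrightarrow> principal_ultrafilter A a \<in> ultra_basic A C" if "a \<in> A" for a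
    using that BC(1,2) ultrafilter_on_principal[OF that]
    by (simp_all add: ultra_basic_def principal_ultrafilter_def)
  with BC show "B = C"
    by blast
qed

lemma ultra_basic_disjnt:
  assumes "B \<inter> C = {}"
  shows "disjnt (ultra_basic A B) (ultra_basic A C)"
  using assms ultrafilter_onD(3,4) by (fastforce simp: disjnt_iff ultra_basic_def)

text \<open>
  Finiteness of the cover is essential: a nonprincipal ultrafilter contains none of the singletons.
\<close>

lemma Union_ultra_basic:
  assumes "finite \<C>" "\<Union>\<C> = A"
  shows "\<Union>(ultra_basic A ` \<C>) = topspace (stone_cech A)"
proof -
  have "\<exists>C\<in>\<C>. C \<in> p" if p: "ultrafilter_on A p" for p
    using ultrafilter_on_finite_Union[OF p assms(1)] assms(2) ultrafilter_onD(2)[OF p] by blast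
  then show ?thesis
    by (auto simp: topspace_stone_cech ultra_basic_def)
qed

context group
begin

lemma stone_cech_action_ultra_basic:
  assumes g: "g \<in> carrier G" and B: "B \<subseteq> carrier G"
  shows "stone_cech_action G g ` ultra_basic (carrier G) B = ultra_basic (carrier G) (g <# B)"
proof -
  interpret group_action G "topspace (stone_cech (carrier G))" "stone_cech_action G"
    using compact_G_space_stone_cech by (simp add: compact_G_space_def)
  have sub: "stone_cech_action G h ` ultra_basic (carrier G) C \<subseteq> ultra_basic (carrier G) (h <# C)"
    if "h \<in> carrier G" for h C
    using that ultrafilter_on_l_coset(1)
    by (auto simp: stone_cech_action_def ultra_basic_def topspace_stone_cech)
  have "ultra_basic (carrier G) (g <# B) \<subseteq> stone_cech_action G g ` ultra_basic (carrier G) B"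
  proof
    fix p assume p: "p \<in> ultra_basic (carrier G) (g <# B)"
    then have "p \<in> topspace (stone_cech (carrier G))"
      by (simp add: ultra_basic_def topspace_stone_cech)
    then have "p = stone_cech_action G g (stone_cech_action G (inv g) p)"
      using g composition_rule[of p g "inv g"] id_eq_one[symmetric] by simp
    moreover have "stone_cech_action G (inv g) p \<in> ultra_basic (carrier G) (inv g <# (g <# B))"
      using sub[of "inv g"] p g by blast
    then have "stone_cech_action G (inv g) p \<in> ultra_basic (carrier G) B"
      using g B by (simp add: lcos_m_assoc lcos_mult_one)
    ultimately show "p \<in> stone_cech_action G g ` ultra_basic (carrier G) B"
      by blast
  qed
  with sub[OF g] show ?thesis
    by blast
qed

lemma l_coset_Int_empty_or_eq:
  assumes "subgroup H G" "a \<in> carrier G" "b \<in> carrier G"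
  shows "a <# H = b <# H \<or> (a <# H) \<inter> (b <# H) = {}"
  using assms l_repr_independence by blast

text \<open>Inversion exchanges the left coset of \<open>a\<close> with the right coset of \<open>a\<^sup>-\<^sup>1\<close>.\<close>

lemma finite_l_cosets:
  assumes H: "subgroup H G" and fin: "finite (rcosets H)"
  shows "finite ((\<lambda>a. a <# H) ` carrier G)"
proof -
  have "a <# H \<in> (`) (m_inv G) ` (rcosets H)" if a: "a \<in> carrier G" for a
  proof -
    have "a <# H = m_inv G ` (H #> inv a)"
    proof
      show "a <# H \<subseteq> m_inv G ` (H #> inv a)"
      proof
        fix x assume "x \<in> a <# H"
        then obtain h where h: "h \<in> H" "x = a \<otimes> h"
          by (auto simp: l_coset_def)
        then have "x = inv (inv h \<otimes> inv a)"
          using a subgroup.mem_carrier[OF H] by (simp add: inv_mult_group)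
        moreover have "inv h \<otimes> inv a \<in> H #> inv a"
          using h subgroup.m_inv_closed[OF H] by (auto simp: r_coset_def)
        ultimately show "x \<in> m_inv G ` (H #> inv a)"
          by blast
      qed
      show "m_inv G ` (H #> inv a) \<subseteq> a <# H"
        using a subgroup.mem_carrier[OF H] subgroup.m_inv_closed[OF H]
        by (auto simp: r_coset_def l_coset_def inv_mult_group)
    qed
    moreover have "H #> inv a \<in> rcosets H"
      using a by (auto simp: RCOSETS_def)
    ultimately show ?thesis
      by blast
  qed
  then have "(\<lambda>a. a <# H) ` carrier G \<subseteq> (`) (m_inv G) ` (rcosets H)"
    by blast
  then show ?thesis
    using fin finite_subset by blast
qed

lemma stabilizer_l_coset:
  assumes H: "subgroup H G" and a: "a \<in> carrier G"
  shows "{g \<in> carrier G. g <# (a <# H) = a <# H} = a <# H #> inv a"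
proof -
  have HG: "H \<subseteq> carrier G"
    by (rule subgroup.subset[OF H])
  have "g <# (a <# H) = a <# H \<longleftrightarrow> inv a \<otimes> g \<otimes> a \<in> H" if g: "g \<in> carrier G" for g
  proof
    assume "g <# (a <# H) = a <# H"
    moreover have "g \<otimes> (a \<otimes> \<one>) \<in> g <# (a <# H)"
      unfolding l_coset_def using subgroup.one_closed[OF H] by blast
    ultimately have "g \<otimes> a \<in> a <# H"
      using a by simp
    then obtain h where h: "h \<in> H" "g \<otimes> a = a \<otimes> h"
      by (auto simp: l_coset_def)
    then have "inv a \<otimes> g \<otimes> a = inv a \<otimes> (a \<otimes> h)"
      using g a by (simp add: m_assoc)
    also have "\<dots> = h"
      using a subgroup.mem_carrier[OF H h(1)] by (simp add: m_assoc[symmetric])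
    finally show "inv a \<otimes> g \<otimes> a \<in> H"
      using h(1) by simp
  next
    assume mem: "inv a \<otimes> g \<otimes> a \<in> H"
    have "g \<otimes> a = a \<otimes> (inv a \<otimes> g \<otimes> a)"
      using g a by (simp add: m_assoc[symmetric])
    then have "g \<otimes> a \<in> a <# H"
      using mem by (auto simp: l_coset_def)
    then show "g <# (a <# H) = a <# H"
      using l_repr_independence[OF _ a H] g a HG by (simp add: lcos_m_assoc)
  qed
  moreover have "g \<in> a <# H #> inv a \<longleftrightarrow> inv a \<otimes> g \<otimes> a \<in> H" if g: "g \<in> carrier G" for g
  proof
    assume "g \<in> a <# H #> inv a"
    then obtain h where h: "h \<in> H" "g = a \<otimes> h \<otimes> inv a"
      by (auto simp: l_coset_def r_coset_def)
    moreover have "inv a \<otimes> (a \<otimes> h) = h"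
      using a subgroup.mem_carrier[OF H h(1)] by (simp add: m_assoc[symmetric])
    ultimately show "inv a \<otimes> g \<otimes> a \<in> H"
      using a subgroup.mem_carrier[OF H h(1)] by (simp add: m_assoc)
  next
    assume mem: "inv a \<otimes> g \<otimes> a \<in> H"
    have "a \<otimes> (inv a \<otimes> g \<otimes> a) = g \<otimes> a"
      using g a by (simp add: m_assoc[symmetric])
    then have "g = a \<otimes> (inv a \<otimes> g \<otimes> a) \<otimes> inv a"
      using g a by (simp add: m_assoc)
    then show "g \<in> a <# H #> inv a"
      using mem by (auto simp: l_coset_def r_coset_def)
  qed
  moreover have "a <# H #> inv a \<subseteq> carrier G"
    using a subgroup.subset[OF H] by (simp add: l_coset_subset_G r_coset_subset_G)
  ultimately show ?thesis
    by blast
qed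

text \<open>
  The blocks are the closures of the left cosets.  Left cosets are the right choice because left
  multiplication permutes them; conjugation invariance of \<open>\<F>\<close> puts all their stabilisers into \<open>\<F>\<close>.
\<close>

lemma stone_cech_open_partition:
  assumes fam: "subgroup_family G \<F>" and H: "H \<in> \<F>" and fin: "finite (rcosets H)"
  shows "\<exists>\<V>. F_cover G \<F> (topspace (stone_cech (carrier G))) (stone_cech_action G) \<V>
    \<and> (\<forall>V\<in>\<V>. openin (stone_cech (carrier G)) V) \<and> pairwise disjnt \<V>"
proof -
  let ?b = "ultra_basic (carrier G)"
  define \<C> where "\<C> = (\<lambda>a. a <# H) ` carrier G"
  have sub: "subgroup H G"
    using fam H by (simp add: subgroup_family_def)
  have C: "C \<subseteq> carrier G" if "C \<in> \<C>" for C
    using that subgroup.subset[OF sub] by (auto simp: \<C>_def dest: l_coset_subset_G)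
  have trans: "g <# C \<in> \<C>" if "g \<in> carrier G" "C \<in> \<C>" for g C
    using that subgroup.subset[OF sub] by (auto simp: \<C>_def lcos_m_assoc)
  have disj: "disjnt (?b B) (?b C)" if "B \<in> \<C>" "C \<in> \<C>" "B \<noteq> C" for B C
    using that l_coset_Int_empty_or_eq[OF sub] unfolding \<C>_def by (intro ultra_basic_disjnt) blast
  have "a \<in> a <# H" if "a \<in> carrier G" for a
    using that subgroup.one_closed[OF sub] by (force simp: l_coset_def)
  then have "\<Union>\<C> = carrier G"
    using C by (auto simp: \<C>_def)
  then have Un: "\<Union>(?b ` \<C>) = topspace (stone_cech (carrier G))"
    using finite_l_cosets[OF sub fin] by (intro Union_ultra_basic) (simp_all add: \<C>_def)
  have F: "F_subset G \<F> (topspace (stone_cech (carrier G))) (stone_cech_action G) (?b C)"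
    if "C \<in> \<C>" for C
    unfolding F_subset_def
  proof (intro conjI ballI)
    show "?b C \<subseteq> topspace (stone_cech (carrier G))"
      by (auto simp: ultra_basic_def topspace_stone_cech)
    show "stone_cech_action G g ` ?b C = stone_cech_action G g' ` ?b C
        \<or> stone_cech_action G g ` ?b C \<inter> stone_cech_action G g' ` ?b C = {}"
      if g: "g \<in> carrier G" "g' \<in> carrier G" for g g'
      using disj[OF trans[OF g(1) \<open>C \<in> \<C>\<close>] trans[OF g(2) \<open>C \<in> \<C>\<close>]] g C[OF \<open>C \<in> \<C>\<close>]
      by (cases "g <# C = g' <# C") (simp_all add: stone_cech_action_ultra_basic disjnt_def)
    obtain a where a: "a \<in> carrier G" "C = a <# H"
      using \<open>C \<in> \<C>\<close> by (auto simp: \<C>_def)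
    have "stone_cech_action G g ` ?b C = ?b C \<longleftrightarrow> g <# C = C" if g: "g \<in> carrier G" for g
      using inj_on_eq_iff[OF inj_on_ultra_basic, of "g <# C" "carrier G" C]
        C[OF trans[OF g \<open>C \<in> \<C>\<close>]] C[OF \<open>C \<in> \<C>\<close>] g
      by (simp add: stone_cech_action_ultra_basic)
    then have "stabilizer G (\<lambda>g. (`) (stone_cech_action G g)) (?b C) = {g \<in> carrier G. g <# C = C}"
      by (auto simp: stabilizer_def)
    also have "\<dots> = a <# H #> inv a"
      unfolding a(2) by (rule stabilizer_l_coset[OF sub a(1)])
    also have "\<dots> \<in> \<F>"
      using fam H a(1) unfolding subgroup_family_def by blast
    finally show "stabilizer G (\<lambda>g. (`) (stone_cech_action G g)) (?b C) \<in> \<F>" .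
  qed
  have "F_cover G \<F> (topspace (stone_cech (carrier G))) (stone_cech_action G) (?b ` \<C>)"
    unfolding F_cover_def
  proof (intro conjI ballI)
    fix V g assume V: "V \<in> ?b ` \<C>" and g: "g \<in> carrier G"
    then obtain B where B: "B \<in> \<C>" "V = ?b B"
      by blast
    have "stone_cech_action G g ` V = ?b (g <# B)"
      unfolding B(2) by (rule stone_cech_action_ultra_basic[OF g C[OF B(1)]])
    then show "stone_cech_action G g ` V \<in> ?b ` \<C>"
      using trans[OF g B(1)] by blast
  qed (use Un F in blast)+
  moreover have "\<forall>V\<in>?b ` \<C>. openin (stone_cech (carrier G)) V"
    using C by (auto intro: openin_ultra_basic)
  moreover have "pairwise disjnt (?b ` \<C>)"
    using disj by (auto simp: pairwise_def)
  ultimately show ?thesis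
    by blast
qed

end

section \<open>Groups of equivariant asymptotic dimension zero\<close>

theorem theoremB:
  fixes G :: "('a, 'c) monoid_scheme" and S :: "'a set" and \<F> :: "'a set set"
  assumes "group G"
    and "finite S" "S \<subseteq> carrier G" "generate G S = carrier G"
    and "subgroup_family G \<F>"
  shows "group_eq_asdim G S \<F> = 0 \<longleftrightarrow> (\<exists>H\<in>\<F>. finite (rcosets\<^bsub>G\<^esub> H))"
proof -
  interpret group G
    by fact
  let ?X = "stone_cech (carrier G)" and ?\<phi> = "stone_cech_action G"
  have ne: "topspace ?X \<noteq> {}"
    using ultrafilter_on_principal[OF one_closed] by (auto simp: topspace_stone_cech)
  have "group_eq_asdim G S \<F> = 0 \<longleftrightarrow> eq_asdim G S \<F> ?X ?\<phi> \<le> 0"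
    using eq_asdim_nonneg[OF ne] by (simp add: group_eq_asdim_def order_eq_iff)
  also have "\<dots> \<longleftrightarrow> (\<exists>\<V>. F_cover G \<F> (topspace ?X) ?\<phi> \<V> \<and> (\<forall>V\<in>\<V>. openin ?X V) \<and> pairwise disjnt \<V>)"
    by (rule eq_asdim_le_0_iff[OF assms(3,4)])
  also have "\<dots> \<longleftrightarrow> (\<exists>H\<in>\<F>. finite (rcosets\<^bsub>G\<^esub> H))"
    using finite_index_if_open_partition[OF assms(5) compact_G_space_stone_cech ne]
      stone_cech_open_partition[OF assms(5)] by blast
  finally show ?thesis .
qed

end
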